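(* Let $G$ be a primitive permutation group on a finite set $\Omega$ with $n=|\Omega|>2$. Then: (a) $G$ synchronizes every map $f:\Omega\to\Omega$ of rank $n-2$; (b) $G$ synchronizes every idempotent map $f:\Omega\to\Omega$ with kernel type $(3,2,1,1,\ldots,1)$; (c) $G$ synchronizes every map $f:\Omega\to\Omega$ with kernel type $(3,2,1,1,\ldots,1)$ for which there exists $g\in G$ such that $\mathrm{rank}(fgf)=\mathrm{rank}(f)$.
   Context: Maps act on $\Omega$, and $fgf$ denotes the composite "apply $f$, then $g$, then $f$". The rank of $f$ is $|\Omega f|$, the size of its image. $G$ synchronizes a non-invertible map $f$ if the semigroup $\langle G,f\rangle$ contains a constant map. The kernel of $f$ is the partition of $\Omega$ into the inverse images of points of the image of $f$; the kernel type is the multiset of sizes of the kernel classes (so $(3,2,1,\ldots,1)$ means one class of size 3, one of size 2, all others singletons). A map $f$ is idempotent if $f\circ f=f$. *)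

theory Defs
  imports Main "HOL-Library.Multiset" "HOL-Library.Cardinality"
begin

text \<open>Omega is modelled as a finite type 'a (Omega = UNIV). Maps act on the left
  as HOL functions; the composite "apply f, then g, then f" is f \<circ> g \<circ> f.\<close>

definition perm_group :: "('a \<Rightarrow> 'a) set \<Rightarrow> bool" where
  "perm_group G \<longleftrightarrow> id \<in> G \<and> (\<forall>g\<in>G. bij g) \<and>
     (\<forall>g\<in>G. \<forall>h\<in>G. g \<circ> h \<in> G) \<and> (\<forall>g\<in>G. inv g \<in> G)"

definition transitive_group :: "('a \<Rightarrow> 'a) set \<Rightarrow> bool" where
  "transitive_group G \<longleftrightarrow> (\<forall>x y. \<exists>g\<in>G. g x = y)"

definition is_block :: "('a \<Rightarrow> 'a) set \<Rightarrow> 'a set \<Rightarrow> bool" where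
  "is_block G B \<longleftrightarrow> (\<forall>g\<in>G. g ` B = B \<or> g ` B \<inter> B = {})"

definition primitive :: "('a \<Rightarrow> 'a) set \<Rightarrow> bool" where
  "primitive G \<longleftrightarrow> perm_group G \<and> transitive_group G \<and>
     (\<forall>B. is_block G B \<longrightarrow> card B \<le> 1 \<or> B = UNIV)"

inductive_set gen_semigroup :: "('a \<Rightarrow> 'a) set \<Rightarrow> ('a \<Rightarrow> 'a) \<Rightarrow> ('a \<Rightarrow> 'a) set"
  for G f where
  gen_G: "g \<in> G \<Longrightarrow> g \<in> gen_semigroup G f"
| gen_f: "f \<in> gen_semigroup G f"
| gen_comp: "a \<in> gen_semigroup G f \<Longrightarrow> b \<in> gen_semigroup G f \<Longrightarrow> a \<circ> b \<in> gen_semigroup G f"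

definition synchronizes :: "('a \<Rightarrow> 'a) set \<Rightarrow> ('a \<Rightarrow> 'a) \<Rightarrow> bool" where
  "synchronizes G f \<longleftrightarrow> (\<exists>h\<in>gen_semigroup G f. \<exists>c. \<forall>x. h x = c)"

definition rank :: "('a \<Rightarrow> 'a) \<Rightarrow> nat" where
  "rank f = card (range f)"

definition kernel_type :: "('a \<Rightarrow> 'a) \<Rightarrow> nat multiset" where
  "kernel_type f = image_mset (\<lambda>y. card (f -` {y})) (mset_set (range f))"

definition idempotent :: "('a \<Rightarrow> 'a) \<Rightarrow> bool" where
  "idempotent f \<longleftrightarrow> f \<circ> f = f"

end

theory Submission
  imports Defs
begin

text \<open>Call two points adjacent if no element of \<open>S = \<langle>G, f\<rangle>\<close> identifies them; \<open>S\<close> acts on this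
  graph by endomorphisms. Let \<open>r\<close> be the minimal rank of an element of \<open>S\<close> and suppose \<open>r > 1\<close>. Images of
  elements of rank \<open>r\<close> are \<open>r\<close>-cliques, and an element of rank \<open>r\<close> maps every \<open>r\<close>-clique onto its image.

  If \<open>x \<noteq> y\<close> and at most one neighbour \<open>u\<close> of \<open>x\<close> is not a neighbour of \<open>y\<close>, there is a contradiction.
  Either some \<open>r\<close>-clique \<open>K\<close> contains \<open>x\<close> but not \<open>u\<close>; then \<open>x\<close> can be exchanged for \<open>y\<close> in \<open>K\<close>, so that
  all elements of rank \<open>r\<close> agree on \<open>x\<close> and \<open>y\<close>, and by primitivity they are constant. Or every
  \<open>r\<close>-clique through \<open>x\<close> contains \<open>u\<close>; by transitivity the two points lie in the same \<open>r\<close>-cliques,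
  and by primitivity all points do, so \<open>r = |\<Omega>|\<close>, although \<open>f\<close> is not injective.

  If \<open>f x = f y = a\<close>, the neighbours of \<open>x\<close> and of \<open>y\<close> are mapped by \<open>f\<close> to the neighbours of \<open>a\<close>. All
  points have the same valency \<open>d\<close>, and for the given kernel types at most \<open>d + 1\<close> points are
  mapped into the \<open>d\<close> neighbours of \<open>a\<close>, if the class over \<open>a\<close> is chosen of maximal size; so \<open>x\<close> and
  \<open>y\<close> are as above.\<close>

text \<open>The \<open>R\<close>-class of \<open>x\<close> is a block with at least two points,
  hence everything.\<close>

lemma primitive_equiv_universal:
  fixes G :: "('a::finite \<Rightarrow> 'a) set"
  assumes G: "primitive G" and R: "equivp R"
    and inv: "\<And>g x y. g \<in> G \<Longrightarrow> R x y \<Longrightarrow> R (g x) (g y)"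
    and xy: "R x y" "x \<noteq> y"
  shows "R z w"
proof -
  define B where "B = {z. R x z}"
  have "is_block G B"
    unfolding is_block_def
  proof
    fix g assume g: "g \<in> G"
    have bij: "bij g" and ig: "inv g \<in> G"
      using G g by (auto simp: primitive_def perm_group_def)
    have *: "g ` B = {z. R (g x) z}"
    proof (intro set_eqI iffI)
      fix z assume "z \<in> g ` B"
      then show "z \<in> {z. R (g x) z}" using inv[OF g] by (auto simp: B_def)
    next
      fix z assume "z \<in> {z. R (g x) z}"
      then have "R (inv g (g x)) (inv g z)" using inv[OF ig] by simp
      then have "inv g z \<in> B" using bij by (simp add: B_def bij_is_inj)
      then show "z \<in> g ` B" using bij by (metis bij_inv_eq_iff image_eqI)
    qed
    have R_eq: "R u = R v" if "R u v" for u v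
      using R that by (simp add: equivp_def)
    show "g ` B = B \<or> g ` B \<inter> B = {}"
      unfolding * unfolding B_def by (cases "R x = R (g x)") (auto dest!: R_eq)
  qed
  moreover have "x \<in> B" "y \<in> B" using R xy by (auto simp: B_def equivp_reflp)
  then have "card B > 1"
    using xy card_mono[of B "{x, y}"] by simp
  ultimately have "B = UNIV"
    using G by (auto simp: primitive_def)
  then show ?thesis
    using R unfolding B_def by (metis UNIV_I equivp_def mem_Collect_eq)
qed

text \<open>Each point of the range outside \<open>insert a N\<close> takes up at least one further
  point of the domain.\<close>

lemma card_vimage_le:
  fixes f :: "'a::finite \<Rightarrow> 'a"
  assumes "CARD('a) \<le> card (f -` {a}) + rank f" "a \<notin> N"
  shows "card (f -` N) \<le> card N + 1"
proof -
  define M where "M = range f - insert a N"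
  have "M = f ` (f -` M)" by (auto simp: M_def)
  then have M: "card M \<le> card (f -` M)" by (metis card_image_le finite)
  have "card (f -` N \<union> f -` {a} \<union> f -` M) = card (f -` N) + card (f -` {a}) + card (f -` M)"
    using assms(2) by (subst card_Un_disjoint; auto simp: M_def card_Un_disjoint disjoint_iff)+
  moreover have "card (f -` N \<union> f -` {a} \<union> f -` M) \<le> CARD('a)"
    by (rule card_mono) auto
  moreover have "rank f \<le> card M + (card N + 1)"
    unfolding rank_def M_def using diff_card_le_card_Diff[of "insert a N" "range f"]
      card_insert_le_m1[of "card N + 1" N a]
    by simp
  ultimately show ?thesis using assms(1) M by linarith
qed

locale primitive_with_map =
  fixes G :: "('a::finite \<Rightarrow> 'a) set" and f :: "'a \<Rightarrow> 'a"
  assumes prim: "primitive G"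
begin

abbreviation S where "S \<equiv> gen_semigroup G f"

definition adj :: "'a \<Rightarrow> 'a \<Rightarrow> bool" where
  "adj x y \<longleftrightarrow> (\<forall>s\<in>S. s x \<noteq> s y)"

definition nbhd :: "'a \<Rightarrow> 'a set" where
  "nbhd x = {y. adj x y}"

definition min_rank :: nat where
  "min_rank = (LEAST r. \<exists>s\<in>S. rank s = r)"

text \<open>These are cliques of maximum size: an element of rank \<open>min_rank\<close> is
  injective on every clique.\<close>

definition max_cliques :: "'a set set" where
  "max_cliques = {K. card K = min_rank \<and> (\<forall>x\<in>K. \<forall>y\<in>K. x \<noteq> y \<longrightarrow> adj x y)}"

lemma G_bij: "g \<in> G \<Longrightarrow> bij g"
  and G_inv: "g \<in> G \<Longrightarrow> inv g \<in> G"
  and id_S: "id \<in> S"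
  and transitive: "\<exists>g\<in>G. g x = y"
  using prim unfolding primitive_def perm_group_def transitive_group_def by (blast intro: gen_G)+

lemma adj_sym: "adj x y \<Longrightarrow> adj y x"
  by (auto simp: adj_def)

lemma adj_irrefl: "\<not> adj x x"
  using id_S by (auto simp: adj_def)

lemma adj_map: "adj x y \<Longrightarrow> s \<in> S \<Longrightarrow> adj (s x) (s y)"
  unfolding adj_def by (metis comp_apply gen_comp)

lemma nbhd_G: "g \<in> G \<Longrightarrow> g ` nbhd x \<subseteq> nbhd (g x)"
  unfolding nbhd_def by (blast intro: adj_map gen_G)

lemma card_nbhd_le: "card (nbhd x) \<le> card (nbhd y)"
proof -
  obtain g where g: "g \<in> G" "g x = y" using transitive by blast
  have "card (nbhd x) = card (g ` nbhd x)"
    using G_bij[OF g(1)] by (metis bij_is_inj card_image inj_on_subset subset_UNIV)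
  also have "\<dots> \<le> card (nbhd y)"
    using nbhd_G[OF g(1), of x] g(2) by (simp add: card_mono)
  finally show ?thesis .
qed

lemma min_rank_le: "s \<in> S \<Longrightarrow> min_rank \<le> rank s"
  unfolding min_rank_def by (blast intro: Least_le)

lemma min_rank_attained: "\<exists>s\<in>S. rank s = min_rank"
  unfolding min_rank_def by (rule LeastI_ex) (use id_S in blast)

lemma range_max_clique:
  assumes h: "h \<in> S" "rank h = min_rank"
  shows "range h \<in> max_cliques"
proof -
  have "adj x y" if xy: "x \<in> range h" "y \<in> range h" "x \<noteq> y" for x y
    unfolding adj_def
  proof (intro ballI notI)
    fix s assume s: "s \<in> S" "s x = s y"
    then have "\<not> inj_on s (range h)" using xy by (auto simp: inj_on_def)
    then have "card (s ` range h) < card (range h)"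
      by (metis card_image_le eq_card_imp_inj_on finite le_neq_implies_less)
    then have "rank (s \<circ> h) < min_rank" using h by (simp add: rank_def image_comp)
    then show False using min_rank_le[OF gen_comp[OF s(1) h(1)]] by simp
  qed
  then show ?thesis using h by (auto simp: max_cliques_def rank_def)
qed

lemma image_max_clique:
  assumes "K \<in> max_cliques" "h \<in> S" "rank h = min_rank"
  shows "h ` K = range h"
proof (rule card_subset_eq)
  have "inj_on h K" using assms by (auto simp: max_cliques_def adj_def inj_on_def)
  then show "card (h ` K) = card (range h)"
    using assms by (simp add: card_image max_cliques_def rank_def)
qed auto

lemma max_clique_G:
  assumes "K \<in> max_cliques" "g \<in> G"
  shows "g ` K \<in> max_cliques"
proof -
  have "card (g ` K) = card K"
    using G_bij[OF assms(2)] by (metis bij_is_inj card_image inj_on_subset subset_UNIV)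
  then show ?thesis using assms by (simp add: max_cliques_def) (metis adj_map gen_G)
qed

lemma ex_max_clique: "\<exists>K\<in>max_cliques. x \<in> K"
proof -
  obtain h where h: "h \<in> S" "rank h = min_rank" using min_rank_attained by blast
  obtain g where g: "g \<in> G" "g (h x) = x" using transitive by blast
  have "g (h x) \<in> g ` range h" by blast
  then have "x \<in> g ` range h" using g(2) by simp
  then show ?thesis by (rule bexI) (intro max_clique_G range_max_clique h g)
qed

lemma card_max_cliques_le:
  "card {K \<in> max_cliques. x \<in> K} \<le> card {K \<in> max_cliques. y \<in> K}"
proof -
  obtain g where g: "g \<in> G" "g x = y" using transitive by blast
  have "inj ((`) g)" using G_bij[OF g(1)] by (simp add: bij_is_inj inj_on_image)
  then have "inj_on ((`) g) {K \<in> max_cliques. x \<in> K}" by (rule inj_on_subset) simp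
  then show ?thesis
    by (rule card_inj_on_le) (use g max_clique_G in auto)
qed

lemma min_rank_agree:
  assumes agree: "\<And>h. h \<in> S \<Longrightarrow> rank h = min_rank \<Longrightarrow> h x = h y" and "x \<noteq> y"
  shows "synchronizes G f"
proof -
  define R where "R z w \<longleftrightarrow> (\<forall>h\<in>S. rank h = min_rank \<longrightarrow> h z = h w)" for z w
  have R: "R z w" for z w
  proof (rule primitive_equiv_universal[OF prim])
    show "equivp R" by (rule equivpI) (simp add: R_def reflp_def symp_def transp_def; metis)+
    show "R (g z) (g w)" if "g \<in> G" "R z w" for g z w
      unfolding R_def
    proof (intro ballI impI)
      fix h assume h: "h \<in> S" "rank h = min_rank"
      \<comment> \<open>Precomposition with a permutation preserves minimal rank, so
        \<open>R\<close> is \<open>G\<close>-invariant.\<close>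
      have "range (h \<circ> g) = range h"
        using G_bij[OF that(1)] by (metis bij_is_surj image_comp)
      then have "rank (h \<circ> g) = min_rank" using h by (simp add: rank_def)
      moreover have "h \<circ> g \<in> S" using h that by (auto intro: gen_comp gen_G)
      ultimately show "h (g z) = h (g w)" using that(2) unfolding R_def by (metis comp_apply)
    qed
    show "R x y" using agree by (simp add: R_def)
  qed fact
  obtain h where h: "h \<in> S" "rank h = min_rank" using min_rank_attained by blast
  then show ?thesis using R unfolding R_def synchronizes_def by blast
qed

lemma max_clique_containment:
  assumes sub: "\<And>K. K \<in> max_cliques \<Longrightarrow> x \<in> K \<Longrightarrow> y \<in> K" and "x \<noteq> y"
  shows "inj f"
proof -
  define R where "R z w \<longleftrightarrow> (\<forall>K\<in>max_cliques. z \<in> K \<longleftrightarrow> w \<in> K)" for z w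
  have R: "R z w" for z w
  proof (rule primitive_equiv_universal[OF prim])
    show "equivp R" by (rule equivpI) (simp_all add: R_def reflp_def symp_def transp_def)
    show "R (g z) (g w)" if "g \<in> G" "R z w" for g z w
      unfolding R_def
    proof
      fix K assume "K \<in> max_cliques"
      then have "inv g ` K \<in> max_cliques" by (intro max_clique_G G_inv that)
      moreover have "v \<in> inv g ` K \<longleftrightarrow> g v \<in> K" for v
        using G_bij[OF that(1)] by (simp flip: bij_vimage_eq_inv_image)
      ultimately show "g z \<in> K \<longleftrightarrow> g w \<in> K" using that(2) by (auto simp: R_def)
    qed
    \<comment> \<open>By transitivity all points lie in equally many maximum cliques, so the
      inclusion is an equality.\<close>
    have "{K \<in> max_cliques. x \<in> K} = {K \<in> max_cliques. y \<in> K}"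
      by (rule card_seteq) (use sub card_max_cliques_le in auto)
    then show "R x y" by (auto simp: R_def)
  qed fact
  obtain K where K: "K \<in> max_cliques" "x \<in> K" using ex_max_clique by blast
  then have "K = UNIV" using R by (auto simp: R_def)
  then have "CARD('a) \<le> rank f"
    using K min_rank_le[OF gen_f] by (auto simp: max_cliques_def)
  then show ?thesis unfolding rank_def
    by (metis card_image_le eq_card_imp_inj_on finite le_antisym)
qed

lemma almost_equal_nbhds:
  assumes "\<not> inj f" "x \<noteq> y" "card (nbhd x - nbhd y) \<le> 1"
  shows "synchronizes G f"
proof -
  obtain u where u: "nbhd x - nbhd y \<subseteq> {u}" "u \<noteq> x"
  proof (cases "nbhd x - nbhd y = {}")
    case True
    \<comment> \<open>Any point other than \<open>x\<close> would serve as \<open>u\<close>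
      here.\<close>
    then show ?thesis using that[of y] \<open>x \<noteq> y\<close> by auto
  next
    case False
    then have "card (nbhd x - nbhd y) = 1"
      using assms(3) by (simp add: le_Suc_eq)
    then obtain u where "nbhd x - nbhd y = {u}" by (rule card_1_singletonE)
    then show ?thesis using that[of u] adj_irrefl[of x] by (auto simp: nbhd_def)
  qed
  obtain K where K: "K \<in> max_cliques" "x \<in> K" "u \<notin> K"
    using max_clique_containment[of x u] assms(1) u(2) by blast
  have nb: "adj y v" if "v \<in> K" "v \<noteq> x" for v
  proof -
    have "adj x v" using that K by (auto simp: max_cliques_def)
    then show ?thesis using u(1) that(1) K(3) by (auto simp: nbhd_def)
  qed
  then have "y \<notin> K" using adj_irrefl \<open>x \<noteq> y\<close> by blast
  define K' where "K' = insert y (K - {x})"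
  have "card K > 0" using K(2) by (auto simp: card_gt_0_iff)
  then have "card K' = card K" using \<open>y \<notin> K\<close> K(2) by (simp add: K'_def)
  then have K': "K' \<in> max_cliques"
    using K(1) nb adj_sym by (auto simp: K'_def max_cliques_def)
  show ?thesis
  proof (rule min_rank_agree[OF _ \<open>x \<noteq> y\<close>])
    fix h assume h: "h \<in> S" "rank h = min_rank"
    \<comment> \<open>Injectivity of \<open>h\<close> on \<open>K\<close> leaves only
      \<open>y\<close> as a preimage of \<open>h x\<close> in \<open>K'\<close>.\<close>
    have "h x \<in> h ` K'" using image_max_clique[OF K' h] by simp
    then obtain v where "v \<in> K'" "h x = h v" by blast
    moreover have "h x \<noteq> h v" if "v \<in> K - {x}" for v
      using K h that by (auto simp: max_cliques_def adj_def)
    ultimately show "h x = h y" unfolding K'_def by blast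
  qed
qed

text \<open>The second hypothesis says that the other \<open>rank f - 1\<close> classes contain at
  most \<open>rank f\<close> points, so at most one of them is not a singleton, and that one has
  size 2.\<close>

lemma large_kernel_class:
  assumes a: "card (f -` {a}) \<ge> 2" "CARD('a) \<le> card (f -` {a}) + rank f"
  shows "synchronizes G f"
proof -
  have "\<not> card (f -` {a}) \<le> Suc 0" using a(1) by simp
  then obtain x y where xy: "x \<noteq> y" "f x = a" "f y = a"
    by (auto simp: card_le_Suc0_iff_eq)
  have pre: "nbhd z \<subseteq> f -` nbhd (f z)" for z
    using adj_map[OF _ gen_f] by (auto simp: nbhd_def)
  have "card (nbhd x - nbhd y) \<le> card (f -` nbhd a - nbhd y)"
    using pre[of x] xy by (intro card_mono) auto
  also have "\<dots> = card (f -` nbhd a) - card (nbhd y)"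
    using pre[of y] xy by (intro card_Diff_subset) auto
  also have "\<dots> \<le> 1"
    using card_vimage_le[OF a(2), of "nbhd a"] adj_irrefl[of a] card_nbhd_le[of a y]
    by (simp add: nbhd_def)
  finally show ?thesis
    using xy by (intro almost_equal_nbhds[of x y]) (auto simp: inj_def)
qed

end

theorem theorem3:
  fixes G :: "('a::finite \<Rightarrow> 'a) set"
  assumes "primitive G" and "CARD('a) > 2"
  shows "(\<forall>f. rank f = CARD('a) - 2 \<longrightarrow> synchronizes G f)
       \<and> (\<forall>f. idempotent f \<and> kernel_type f = {#3, 2#} + replicate_mset (CARD('a) - 5) 1
              \<longrightarrow> synchronizes G f)
       \<and> (\<forall>f. kernel_type f = {#3, 2#} + replicate_mset (CARD('a) - 5) 1
              \<and> (\<exists>g\<in>G. rank (f \<circ> g \<circ> f) = rank f) \<longrightarrow> synchronizes G f)"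
proof -
  have sync: "synchronizes G f"
    if "card (f -` {a}) \<ge> 2" "CARD('a) \<le> card (f -` {a}) + rank f" for f a
    using primitive_with_map.large_kernel_class[OF _ that] assms(1)
    by (simp add: primitive_with_map_def)
  have corank2: "synchronizes G f" if r: "rank f = CARD('a) - 2" for f
  proof -
    have "\<not> inj f" using r assms(2) card_image[of f UNIV] by (auto simp: rank_def)
    then obtain x y where xy: "x \<noteq> y" "f x = f y" by (auto simp: inj_def)
    then have "card {x, y} \<le> card (f -` {f y})" by (intro card_mono) auto
    \<comment> \<open>At corank 2 any class with two points is large enough.\<close>
    then show ?thesis using xy r by (intro sync[where a = "f y"]) auto
  qed
  have type32: "synchronizes G f"
    if k: "kernel_type f = {#3, 2#} + replicate_mset (CARD('a) - 5) 1" for f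
  proof -
    have "3 \<in># kernel_type f" using k by simp
    then obtain a where a: "card (f -` {a}) = 3" by (auto simp: kernel_type_def)
    \<comment> \<open>The rank is \<open>2 + (CARD('a) - 5)\<close>, at least
      \<open>CARD('a) - 3\<close> even if the subtraction truncates.\<close>
    have "rank f = size (kernel_type f)" by (simp add: kernel_type_def rank_def)
    then show ?thesis using a k by (intro sync[where a = a]) auto
  qed
  show ?thesis using corank2 type32 by blast
qed

end
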